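(* Let $(V_1,V_2)$ be a pair of commuting isometries on a Hilbert space $\mathcal H$. Then the following are equivalent: (i) $H(V_1,V_2)\geq 0$. (ii) There exists an isometry $V_3$ on $\mathcal H$ commuting with $V_2$ such that $V_1=V_2V_3$ and $C(V_3,V_2)\geq 0$. (iii) $V_1(\mathcal W(V_2))\subseteq V_2(\mathcal W(V_2))$.
   Context: Hilbert spaces are complex. For a pair $(V_1,V_2)$ of commuting isometries on $\mathcal H$, the Hartogs triangle core operator is $H(V_1,V_2):=V_2V_2^*-V_1V_1^*-V_2^2V_2^{*2}+V_1V_2V_1^*V_2^*$, and the bidisc core operator is $C(V_1,V_2):=I-V_1V_1^*-V_2V_2^*+V_1V_2V_1^*V_2^*$. For an isometry $V$ on $\mathcal H$, $\mathcal W(V):=\mathcal H\ominus V\mathcal H=\ker V^*$ is its wandering subspace. For a self-adjoint operator $T$, $T\ge 0$ means $\langle Tx,x\rangle\ge 0$ for all $x$. *)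

theory Defs
  imports "HOL-Analysis.Analysis"
begin

section \<open>Complex Hilbert spaces\<close>

class complex_vector = real_vector +
  fixes scaleC :: "complex \<Rightarrow> 'a \<Rightarrow> 'a" (infixr "*\<^sub>C" 75)
  assumes scaleC_add_right: "a *\<^sub>C (x + y) = a *\<^sub>C x + a *\<^sub>C y"
    and scaleC_add_left: "(a + b) *\<^sub>C x = a *\<^sub>C x + b *\<^sub>C x"
    and scaleC_scaleC: "a *\<^sub>C b *\<^sub>C x = (a * b) *\<^sub>C x"
    and scaleR_scaleC: "r *\<^sub>R x = complex_of_real r *\<^sub>C x"

text \<open>The inner product is linear in its first argument and conjugate-linear in its second.\<close>

class complex_inner = complex_vector + real_normed_vector +
  fixes cinner :: "'a \<Rightarrow> 'a \<Rightarrow> complex"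
  assumes cinner_commute: "cinner x y = cnj (cinner y x)"
    and cinner_add_left: "cinner (x + y) z = cinner x z + cinner y z"
    and cinner_scaleC_left: "cinner (a *\<^sub>C x) y = a * cinner x y"
    and cinner_ge_zero: "0 \<le> Re (cinner x x)"
    and cinner_eq_zero_iff: "cinner x x = 0 \<longleftrightarrow> x = 0"
    and norm_eq_sqrt_cinner: "norm x = sqrt (Re (cinner x x))"

class chilbert_space = complex_inner + complete_space

lemma vector_space_scaleC: "vector_space (scaleC :: complex \<Rightarrow> 'a \<Rightarrow> 'a::complex_vector)"
proof
  show "1 *\<^sub>C x = x" for x :: 'a
    using scaleR_scaleC[of 1 x] by simp
qed (simp_all add: scaleC_add_right scaleC_add_left scaleC_scaleC)

text \<open>The axioms are satisfiable: the scalar field is a complex Hilbert space.\<close>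

instantiation complex :: chilbert_space
begin

definition scaleC_complex :: "complex \<Rightarrow> complex \<Rightarrow> complex" where
  "scaleC_complex a x = a * x"

definition cinner_complex :: "complex \<Rightarrow> complex \<Rightarrow> complex" where
  "cinner_complex x y = x * cnj y"

instance
proof
  show "r *\<^sub>R x = complex_of_real r *\<^sub>C x" for r and x :: complex
    by (simp add: scaleC_complex_def scaleR_conv_of_real)
  show "norm x = sqrt (Re (cinner x x))" for x :: complex
    by (simp add: cinner_complex_def cmod_def power2_eq_square)
qed (simp_all add: scaleC_complex_def cinner_complex_def algebra_simps)

end

section \<open>Operators\<close>

abbreviation clinear :: "('a::complex_vector \<Rightarrow> 'b::complex_vector) \<Rightarrow> bool" where
  "clinear \<equiv> Vector_Spaces.linear scaleC scaleC"

lemma clinear_iff: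
  "clinear T \<longleftrightarrow> (\<forall>x y. T (x + y) = T x + T y) \<and> (\<forall>a x. T (a *\<^sub>C x) = a *\<^sub>C T x)"
  using vector_space_scaleC vector_space_scaleC
  by (auto simp: Vector_Spaces.linear_iff)

definition is_isometry :: "('a::complex_inner \<Rightarrow> 'a) \<Rightarrow> bool" where
  "is_isometry V \<longleftrightarrow> clinear V \<and> (\<forall>x. norm (V x) = norm x)"

text \<open>By Riesz, every bounded operator on a Hilbert space has exactly one adjoint, so the choice
  below is determined for the operators under consideration. For other arguments the value of
  \<open>cadjoint\<close> is meaningless.\<close>

definition cadjoint :: "('a::complex_inner \<Rightarrow> 'a) \<Rightarrow> 'a \<Rightarrow> 'a" where
  "cadjoint T = (SOME S. \<forall>x y. cinner (T x) y = cinner x (S y))"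

lemma cadjoint_eqI:
  fixes T S :: "'a::complex_inner \<Rightarrow> 'a"
  assumes "\<And>x y. cinner (T x) y = cinner x (S y)"
  shows "cadjoint T = S"
proof
  fix y
  have *: "\<forall>x y. cinner (T x) y = cinner x (cadjoint T y)"
    unfolding cadjoint_def by (rule someI[of _ S]) (use assms in auto)
  have add: "cinner (cadjoint T y) x = cinner (S y) x" for x
    by (metis * assms cinner_commute)
  have "cinner (cadjoint T y - S y) x = 0" for x
    using cinner_add_left[of "cadjoint T y - S y" "S y" x] add[of x] by simp
  then show "cadjoint T y = S y"
    by (metis cinner_eq_zero_iff eq_iff_diff_eq_0)
qed

text \<open>Positivity \<open>T \<ge> 0\<close>: the inner product is required to be real and nonnegative. On a complex
  Hilbert space this already forces a bounded \<open>T\<close> to be self-adjoint.\<close>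

definition positive_op :: "('a::complex_inner \<Rightarrow> 'a) \<Rightarrow> bool" where
  "positive_op T \<longleftrightarrow> (\<forall>x. cinner (T x) x \<in> \<real>\<^sub>\<ge>\<^sub>0)"

definition wandering_subspace :: "('a::complex_inner \<Rightarrow> 'a) \<Rightarrow> 'a set" where
  "wandering_subspace V = {x. \<forall>y\<in>range V. cinner x y = 0}"

definition hartogs_core :: "('a::complex_inner \<Rightarrow> 'a) \<Rightarrow> ('a \<Rightarrow> 'a) \<Rightarrow> 'a \<Rightarrow> 'a" where
  "hartogs_core V1 V2 = (\<lambda>x.
     V2 (cadjoint V2 x) - V1 (cadjoint V1 x)
     - (V2 ^^ 2) ((cadjoint V2 ^^ 2) x)
     + V1 (V2 (cadjoint V1 (cadjoint V2 x))))"

definition bidisc_core :: "('a::complex_inner \<Rightarrow> 'a) \<Rightarrow> ('a \<Rightarrow> 'a) \<Rightarrow> 'a \<Rightarrow> 'a" where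
  "bidisc_core V1 V2 = (\<lambda>x.
     x - V1 (cadjoint V1 x) - V2 (cadjoint V2 x)
     + V1 (V2 (cadjoint V1 (cadjoint V2 x))))"

end

theory Submission
  imports Defs
begin

text \<open>
  Let \<open>P = I - V\<^sub>2V\<^sub>2\<^sup>*\<close> be the projection onto \<open>\<W>(V\<^sub>2)\<close>. Expanding the quadratic forms gives
  \<open>\<langle>H(V\<^sub>1,V\<^sub>2)x,x\<rangle> = \<parallel>PV\<^sub>2\<^sup>*x\<parallel>\<^sup>2 - \<parallel>PV\<^sub>1\<^sup>*x\<parallel>\<^sup>2\<close>, so \<open>H(V\<^sub>1,V\<^sub>2)\<close> is the difference of the projections
  onto \<open>V\<^sub>2\<W>(V\<^sub>2)\<close> and \<open>V\<^sub>1\<W>(V\<^sub>2)\<close>; it is positive iff the second space lies in the first.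
  That inclusion yields \<open>V\<^sub>1\<H> \<subseteq> V\<^sub>2\<H>\<close>, because \<open>V\<^sub>1h = V\<^sub>1Ph + V\<^sub>2V\<^sub>1V\<^sub>2\<^sup>*h\<close>. Hence \<open>V\<^sub>1\<close> factors as
  \<open>V\<^sub>2V\<^sub>3\<close>, and for every such factorization \<open>H(V\<^sub>1,V\<^sub>2) = V\<^sub>2 C(V\<^sub>3,V\<^sub>2) V\<^sub>2\<^sup>*\<close>, so the two
  positivity conditions agree.
\<close>

section \<open>Inner products and orthogonal projections\<close>

interpretation complex_vs: vector_space "scaleC :: complex \<Rightarrow> 'a \<Rightarrow> 'a::complex_vector"
  by (rule vector_space_scaleC)

lemma cinner_minus_left: "cinner (- x) y = - cinner x (y :: 'a::complex_inner)"
  by (metis add_eq_0_iff cinner_add_left add.right_inverse add_cancel_left_left)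

lemma cinner_diff_left: "cinner (x - y) z = cinner x z - cinner y (z :: 'a::complex_inner)"
  by (metis cinner_add_left cinner_minus_left diff_conv_add_uminus)

lemma cinner_add_right: "cinner x (y + z) = cinner x y + cinner x (z :: 'a::complex_inner)"
  by (metis cinner_add_left cinner_commute complex_cnj_add)

lemma cinner_diff_right: "cinner x (y - z) = cinner x y - cinner x (z :: 'a::complex_inner)"
  by (metis cinner_diff_left cinner_commute complex_cnj_diff)

lemma cinner_scaleC_right: "cinner x (a *\<^sub>C y) = cnj a * cinner x (y :: 'a::complex_inner)"
  by (metis cinner_scaleC_left cinner_commute complex_cnj_mult)

lemma cinner_self: "cinner x x = of_real ((norm (x :: 'a::complex_inner))\<^sup>2)"
proof -
  have "cnj (cinner x x) = cinner x x"
    by (metis cinner_commute)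
  then show ?thesis
    by (simp add: norm_eq_sqrt_cinner cinner_ge_zero complex_eq_iff)
qed

lemma power2_norm_eq_Re_cinner: "(norm (x :: 'a::complex_inner))\<^sup>2 = Re (cinner x x)"
  by (simp add: cinner_self)

lemma Re_cinner_commute: "Re (cinner x y) = Re (cinner y (x :: 'a::complex_inner))"
  by (metis cinner_commute complex_cnj(1) complex.sel(1) complex.exhaust_sel)

lemma power2_norm_diff:
  "(norm (x - y :: 'a::complex_inner))\<^sup>2 = (norm x)\<^sup>2 - 2 * Re (cinner x y) + (norm y)\<^sup>2"
  using Re_cinner_commute[of x y]
  by (simp add: power2_norm_eq_Re_cinner cinner_diff_left cinner_diff_right)

lemma norm_scaleC: "norm (c *\<^sub>C x) = cmod c * norm (x :: 'a::complex_inner)"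
proof -
  have "cinner (c *\<^sub>C x) (c *\<^sub>C x) = (c * cnj c) * cinner x x"
    by (simp add: cinner_scaleC_left cinner_scaleC_right mult.left_commute)
  also have "\<dots> = of_real ((cmod c * norm x)\<^sup>2)"
    unfolding complex_norm_square[symmetric] cinner_self by (simp add: power_mult_distrib)
  finally have "(norm (c *\<^sub>C x))\<^sup>2 = (cmod c * norm x)\<^sup>2"
    unfolding cinner_self of_real_eq_iff .
  then show ?thesis
    by (simp add: power2_eq_iff_nonneg)
qed

lemma two_Re_cinner_le: "2 * Re (cinner x y) \<le> (norm x)\<^sup>2 + (norm (y :: 'a::complex_inner))\<^sup>2"
  using power2_norm_diff[of x y] zero_le_power2[of "norm (x - y)"] by linarith

section \<open>Orthogonal projection onto a complete subspace\<close>

lemma parallelogram_midpoint: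
  fixes a b y :: "'a::complex_inner"
  shows "(norm (a - b))\<^sup>2 =
    2 * (norm (y - a))\<^sup>2 + 2 * (norm (y - b))\<^sup>2 - 4 * (norm (y - (1/2) *\<^sub>R (a + b)))\<^sup>2"
  using Re_cinner_commute[of a b] Re_cinner_commute[of a y] Re_cinner_commute[of b y]
  by (simp add: power2_norm_eq_Re_cinner scaleR_scaleC cinner_diff_left cinner_diff_right
      cinner_add_left cinner_add_right cinner_scaleC_left cinner_scaleC_right algebra_simps)

text \<open>Otherwise, removing from \<open>u\<close> its component along \<open>z\<close> would
  shorten it: the squared norm drops by \<open>|cinner u z|^2 / |z|^2\<close>.\<close>

lemma cinner_eq_0_if_closest:
  fixes u z :: "'a::complex_inner"
  assumes "\<And>c. norm u \<le> norm (u - c *\<^sub>C z)"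
  shows "cinner u z = 0"
proof (cases "z = 0")
  case True
  then show ?thesis
    using cinner_diff_right[of u 0 0] by simp
next
  case False
  \<comment> \<open>The coefficient of the orthogonal projection of \<open>u\<close> onto the line
    through \<open>z\<close>.\<close>
  define c where "c = cinner u z / of_real ((norm z)\<^sup>2)"
  have c: "cnj c * cinner u z = of_real ((cmod (cinner u z))\<^sup>2 / (norm z)\<^sup>2)"
    by (simp add: c_def complex_norm_square[symmetric] mult.commute)
  have "(norm (c *\<^sub>C z))\<^sup>2 = (cmod c)\<^sup>2 * (norm z)\<^sup>2"
    by (simp add: norm_scaleC power_mult_distrib)
  also have "\<dots> = (cmod (cinner u z))\<^sup>2 / (norm z)\<^sup>2"
    using False by (simp add: c_def norm_divide power_divide norm_mult power2_eq_square)
  finally have "(norm (u - c *\<^sub>C z))\<^sup>2 = (norm u)\<^sup>2 - (cmod (cinner u z))\<^sup>2 / (norm z)\<^sup>2"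
    unfolding power2_norm_diff cinner_scaleC_right c by simp
  moreover have "(norm u)\<^sup>2 \<le> (norm (u - c *\<^sub>C z))\<^sup>2"
    by (simp add: assms)
  ultimately have "(cmod (cinner u z))\<^sup>2 / (norm z)\<^sup>2 \<le> 0"
    by simp
  then show ?thesis
    using False by (simp add: divide_le_0_iff)
qed

text \<open>Midpoints stay in \<open>M\<close>, so the parallelogram law makes a minimizing sequence
  Cauchy; completeness supplies the limit. Squared distances are minimized because the parallelogram
  law is stated for squares.\<close>

lemma closest_point_subspace_exists:
  fixes M :: "'a::complex_inner set"
  assumes "complete M" and sub: "complex_vs.subspace M"
  obtains m where "m \<in> M" and "\<And>z. z \<in> M \<Longrightarrow> norm (y - m) \<le> norm (y - z)"
proof -
  define d where "d = (INF z\<in>M. (norm (y - z))\<^sup>2)"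
  have "0 \<in> M"
    by (rule complex_vs.subspace_0[OF sub])
  have bdd: "bdd_below ((\<lambda>z. (norm (y - z))\<^sup>2) ` M)"
    by (rule bdd_belowI[of _ 0]) auto
  have d_le: "d \<le> (norm (y - z))\<^sup>2" if "z \<in> M" for z
    unfolding d_def by (rule cINF_lower[OF bdd that])
  have "\<exists>z\<in>M. (norm (y - z))\<^sup>2 < d + inverse (real (Suc n))" for n
    using cINF_less_iff[OF _ bdd, of "d + inverse (real (Suc n))"] \<open>0 \<in> M\<close>
    unfolding d_def[symmetric] by (force simp del: of_nat_Suc)
  then obtain f where fM: "\<And>n. f n \<in> M"
    and f: "\<And>n. (norm (y - f n))\<^sup>2 < d + inverse (real (Suc n))"
    by metis
  have mid: "(1/2) *\<^sub>R (a + b) \<in> M" if "a \<in> M" "b \<in> M" for a b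
    unfolding scaleR_scaleC
    by (intro complex_vs.subspace_scale[OF sub] complex_vs.subspace_add[OF sub] that)
  \<comment> \<open>The midpoint of \<open>f m\<close> and \<open>f n\<close> is at squared distance
    at least \<open>d\<close> from \<open>y\<close>, so the term \<open>- 4 * ...\<close> cancels
    the \<open>4 * d\<close> contributed by the two points.\<close>
  have dist2: "(norm (f m - f n))\<^sup>2 < 2 * inverse (real (Suc m)) + 2 * inverse (real (Suc n))" for m n
    using parallelogram_midpoint[of "f m" "f n" y] d_le[OF mid[OF fM[of m] fM[of n]]] f[of m] f[of n]
    by linarith
  have "Cauchy f"
    unfolding Cauchy_altdef2
  proof (intro allI impI)
    fix e :: real
    assume "0 < e"
    \<comment> \<open>Both terms of \<open>dist2\<close> are at most
      \<open>2 * inverse (real (Suc N))\<close>; a quarter of \<open>e^2\<close> makes their sum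
      smaller than \<open>e^2\<close>.\<close>
    then obtain N where N: "inverse (real (Suc N)) < e\<^sup>2 / 4"
      using reals_Archimedean[of "e\<^sup>2 / 4"] by auto
    have "dist (f n) (f N) < e" if "N \<le> n" for n
    proof -
      have "inverse (real (Suc n)) \<le> inverse (real (Suc N))"
        using that by simp
      then have "(norm (f n - f N))\<^sup>2 < e\<^sup>2"
        using dist2[of n N] N by linarith
      then show ?thesis
        using \<open>0 < e\<close> by (simp add: dist_norm power2_less_imp_less)
    qed
    then show "\<exists>N. \<forall>n\<ge>N. dist (f n) (f N) < e"
      by blast
  qed
  then obtain m where "m \<in> M" and lim: "f \<longlonglongrightarrow> m"
    using \<open>complete M\<close> fM unfolding complete_def by blast
  have "(\<lambda>n. (norm (y - f n))\<^sup>2) \<longlonglongrightarrow> (norm (y - m))\<^sup>2"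
    by (intro tendsto_intros lim)
  moreover have "(\<lambda>n. d + inverse (real (Suc n))) \<longlonglongrightarrow> d + 0"
    by (intro tendsto_intros LIMSEQ_inverse_real_of_nat)
  ultimately have "(norm (y - m))\<^sup>2 \<le> d"
    using f by (intro LIMSEQ_le[of _ _ _ "d"]) (auto intro: less_imp_le)
  then have "norm (y - m) \<le> norm (y - z)" if "z \<in> M" for z
    using d_le[OF that] by (simp add: power2_le_imp_le)
  with \<open>m \<in> M\<close> show ?thesis
    by (rule that)
qed

lemma orthogonal_projection_exists:
  fixes M :: "'a::complex_inner set"
  assumes "complete M" and sub: "complex_vs.subspace M"
  obtains m where "m \<in> M" and "\<And>z. z \<in> M \<Longrightarrow> cinner (y - m) z = 0"
proof -
  obtain m where "m \<in> M" and m: "\<And>z. z \<in> M \<Longrightarrow> norm (y - m) \<le> norm (y - z)"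
    using closest_point_subspace_exists[OF assms, where y = y] by blast
  have "cinner (y - m) z = 0" if "z \<in> M" for z
  proof (rule cinner_eq_0_if_closest)
    fix c
    have "m + c *\<^sub>C z \<in> M"
      by (intro complex_vs.subspace_scale[OF sub] complex_vs.subspace_add[OF sub] that \<open>m \<in> M\<close>)
    then show "norm (y - m) \<le> norm (y - m - c *\<^sub>C z)"
      using m by (metis diff_diff_eq)
  qed
  with \<open>m \<in> M\<close> show ?thesis
    by (rule that)
qed

section \<open>Isometries and their adjoints\<close>

lemma is_isometry_clinear: "is_isometry V \<Longrightarrow> clinear V"
  by (simp add: is_isometry_def)

lemma is_isometry_norm: "is_isometry V \<Longrightarrow> norm (V x) = norm x"
  by (simp add: is_isometry_def)

lemma is_isometry_add: "is_isometry V \<Longrightarrow> V (x + y) = V x + V y"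
  by (simp add: is_isometry_def clinear_iff)

lemma is_isometry_scaleC: "is_isometry V \<Longrightarrow> V (a *\<^sub>C x) = a *\<^sub>C V x"
  by (simp add: is_isometry_def clinear_iff)

lemma is_isometry_diff: "is_isometry V \<Longrightarrow> V (x - y) = V x - V y"
  using is_isometry_add[of V "x - y" y] by simp

lemma is_isometry_cancel: "is_isometry V \<Longrightarrow> V x = V y \<longleftrightarrow> x = y"
  using is_isometry_norm[of V "x - y"] by (auto simp: is_isometry_diff)

text \<open>Polarization: norms of differences determine real parts, and replacing \<open>x\<close>
  by the imaginary unit times \<open>x\<close> recovers imaginary parts.\<close>

lemma is_isometry_cinner:
  assumes "is_isometry V"
  shows "cinner (V x) (V y) = cinner x y"
proof -
  have Re: "Re (cinner (V a) (V b)) = Re (cinner a b)" for a b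
    using power2_norm_diff[of "V a" "V b"] power2_norm_diff[of a b]
    by (simp add: is_isometry_diff[OF assms, symmetric] is_isometry_norm[OF assms])
  show ?thesis
    using Re[of x y] Re[of "\<i> *\<^sub>C x" y]
    by (simp add: complex_eq_iff is_isometry_scaleC[OF assms] cinner_scaleC_left)
qed

lemma complete_range_isometry:
  fixes V :: "'a::chilbert_space \<Rightarrow> 'a"
  assumes "is_isometry V"
  shows "complete (range V)"
proof (rule complete_isometric_image[of 1])
  show "bounded_linear V"
    by (rule bounded_linear_intro[of _ 1])
      (simp_all add: is_isometry_add[OF assms] is_isometry_scaleC[OF assms] scaleR_scaleC
        is_isometry_norm[OF assms])
qed (simp_all add: is_isometry_norm[OF assms] subspace_UNIV complete_UNIV)

text \<open>\<open>cadjoint\<close> is a choice, so an adjoint must be exhibited. The range of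
  \<open>V\<close> is a complete subspace; the adjoint sends \<open>y\<close> to the preimage under
  \<open>V\<close> of the projection of \<open>y\<close> onto it.\<close>

lemma cinner_cadjoint_right:
  fixes V :: "'a::chilbert_space \<Rightarrow> 'a"
  assumes V: "is_isometry V"
  shows "cinner (V x) y = cinner x (cadjoint V y)"
proof -
  have sub: "complex_vs.subspace (range V)"
    by (rule module_hom.subspace_image[OF is_isometry_clinear[OF V, unfolded linear_iff_module_hom]
          complex_vs.subspace_UNIV])
  have "\<exists>s. \<forall>x. cinner (V x) y = cinner x s" for y
  proof -
    obtain s where s: "\<And>x. cinner (y - V s) (V x) = 0"
      using orthogonal_projection_exists[OF complete_range_isometry[OF V] sub] by (metis rangeE rangeI)
    have "cinner (V x) y = cinner (V x) (V s)" for x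
    proof -
      have "cinner (V x) (y - V s) = 0"
        using s[of x] by (metis cinner_commute complex_cnj_zero)
      then show ?thesis
        by (simp add: cinner_diff_right)
    qed
    then show ?thesis
      using is_isometry_cinner[OF V] by auto
  qed
  then obtain S where "\<And>x y. cinner (V x) y = cinner x (S y)"
    by metis
  then show ?thesis
    using cadjoint_eqI by metis
qed

lemma cinner_cadjoint_left:
  fixes V :: "'a::chilbert_space \<Rightarrow> 'a"
  assumes "is_isometry V"
  shows "cinner x (V y) = cinner (cadjoint V x) y"
  by (metis cinner_cadjoint_right[OF assms] cinner_commute)

lemma cadjoint_comp:
  fixes S T :: "'a::chilbert_space \<Rightarrow> 'a"
  assumes "is_isometry S" and "is_isometry T"
  shows "cadjoint (S \<circ> T) = cadjoint T \<circ> cadjoint S"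
  by (rule cadjoint_eqI) (simp add: cinner_cadjoint_right assms)

lemma cadjoint_apply:
  fixes V :: "'a::chilbert_space \<Rightarrow> 'a"
  assumes "is_isometry V"
  shows "cadjoint V (V x) = x"
proof -
  have "cadjoint V \<circ> V = cadjoint id"
    by (rule sym, rule cadjoint_eqI)
      (simp add: cinner_cadjoint_right[OF assms, symmetric] is_isometry_cinner[OF assms])
  moreover have "cadjoint id = (id :: 'a \<Rightarrow> 'a)"
    by (rule cadjoint_eqI) simp
  ultimately show ?thesis
    by (metis comp_apply id_apply)
qed

section \<open>The wandering subspace and its orthogonal projection\<close>

lemma mem_wandering_subspace_iff:
  fixes V :: "'a::chilbert_space \<Rightarrow> 'a"
  assumes "is_isometry V"
  shows "x \<in> wandering_subspace V \<longleftrightarrow> cadjoint V x = 0"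
proof -
  have zero: "cinner 0 y = 0" for y :: 'a
    using cinner_diff_left[of 0 0 y] by simp
  show ?thesis
    using cinner_eq_zero_iff[of "cadjoint V x"]
    by (auto simp: wandering_subspace_def cinner_cadjoint_left[OF assms] zero)
qed

definition wandering_proj :: "('a::complex_inner \<Rightarrow> 'a) \<Rightarrow> 'a \<Rightarrow> 'a" where
  "wandering_proj V x = x - V (cadjoint V x)"

lemma wandering_proj_mem:
  fixes V :: "'a::chilbert_space \<Rightarrow> 'a"
  assumes "is_isometry V"
  shows "wandering_proj V x \<in> wandering_subspace V"
  by (auto simp: wandering_proj_def wandering_subspace_def cinner_diff_left
      is_isometry_cinner[OF assms] cinner_cadjoint_left[OF assms, symmetric])

lemma wandering_proj_ident:
  fixes V :: "'a::chilbert_space \<Rightarrow> 'a"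
  assumes "is_isometry V" and "x \<in> wandering_subspace V"
  shows "wandering_proj V x = x"
  using assms is_isometry_norm[OF assms(1), of 0]
  by (simp add: wandering_proj_def mem_wandering_subspace_iff)

lemma cinner_wandering_proj_right:
  fixes V :: "'a::chilbert_space \<Rightarrow> 'a"
  assumes "w \<in> wandering_subspace V"
  shows "cinner w (wandering_proj V x) = cinner w x"
  using assms by (simp add: wandering_proj_def wandering_subspace_def cinner_diff_right)

text \<open>Pythagoras: the part removed from \<open>x\<close> is \<open>V (cadjoint V x)\<close>,
  whose norm is that of \<open>cadjoint V x\<close>. This turns differences of squared norms in the
  core operators into single norms.\<close>

lemma power2_norm_wandering_proj:
  fixes V :: "'a::chilbert_space \<Rightarrow> 'a"
  assumes "is_isometry V"
  shows "(norm (wandering_proj V x))\<^sup>2 = (norm x)\<^sup>2 - (norm (cadjoint V x))\<^sup>2"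
  unfolding wandering_proj_def power2_norm_diff
  by (simp add: is_isometry_norm[OF assms] cinner_cadjoint_left[OF assms] cinner_self)

section \<open>The core operators\<close>

lemma positive_op_iff_norm_le:
  assumes "\<And>x. cinner (T x) x = of_real ((norm (f x))\<^sup>2 - (norm (g x))\<^sup>2)"
  shows "positive_op T \<longleftrightarrow> (\<forall>x. norm (g x) \<le> norm (f x))"
  unfolding positive_op_def assms by (simp add: nonneg_Reals_of_real_iff del: of_real_diff)

context
  fixes V1 V2 :: "'a::chilbert_space \<Rightarrow> 'a"
  assumes V1: "is_isometry V1" and V2: "is_isometry V2" and comm: "V1 \<circ> V2 = V2 \<circ> V1"
begin

lemma cadjoint_commute: "cadjoint V1 (cadjoint V2 x) = cadjoint V2 (cadjoint V1 x)"
  using cadjoint_comp[OF V1 V2] cadjoint_comp[OF V2 V1] comm by (metis comp_apply)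

text \<open>The two terms in \<open>V2\<close> alone combine to \<open>|P V2* x|^2\<close>, where
  \<open>P\<close> is \<open>wandering_proj V2\<close>. The remaining two give
  \<open>- |P V1* x|^2\<close>, once the adjoints are commuted.\<close>

lemma positive_hartogs_core_iff:
  "positive_op (hartogs_core V1 V2) \<longleftrightarrow>
   (\<forall>x. norm (wandering_proj V2 (cadjoint V1 x)) \<le> norm (wandering_proj V2 (cadjoint V2 x)))"
proof (rule positive_op_iff_norm_le)
  have funpow_2: "(f ^^ 2) y = f (f y)" for f :: "'a \<Rightarrow> 'a" and y
    by (simp add: numeral_2_eq_2)
  show "cinner (hartogs_core V1 V2 x) x =
    of_real ((norm (wandering_proj V2 (cadjoint V2 x)))\<^sup>2 -
      (norm (wandering_proj V2 (cadjoint V1 x)))\<^sup>2)" for x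
    by (simp add: hartogs_core_def funpow_2 cinner_diff_left cinner_add_left
        cinner_cadjoint_right V1 V2 cinner_self power2_norm_wandering_proj cadjoint_commute)
qed

lemma positive_bidisc_core_iff:
  "positive_op (bidisc_core V1 V2) \<longleftrightarrow>
   (\<forall>x. norm (wandering_proj V2 (cadjoint V1 x)) \<le> norm (wandering_proj V2 x))"
proof (rule positive_op_iff_norm_le)
  show "cinner (bidisc_core V1 V2 x) x =
    of_real ((norm (wandering_proj V2 x))\<^sup>2 - (norm (wandering_proj V2 (cadjoint V1 x)))\<^sup>2)" for x
    by (simp add: bidisc_core_def cinner_diff_left cinner_add_left
        cinner_cadjoint_right V1 V2 cinner_self power2_norm_wandering_proj cadjoint_commute)
qed

text \<open>Moving adjoints across gives \<open>|w|^2 = <V1 w, x> = <V2 u, x> = <u, P V2* x>\<close>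
  with \<open>|u| = |w|\<close>, and this pairing is bounded by norms.\<close>

lemma wandering_image_subset_imp_norm_le:
  assumes "V1 ` wandering_subspace V2 \<subseteq> V2 ` wandering_subspace V2"
  shows "norm (wandering_proj V2 (cadjoint V1 x)) \<le> norm (wandering_proj V2 (cadjoint V2 x))"
proof -
  define w where "w = wandering_proj V2 (cadjoint V1 x)"
  have w: "w \<in> wandering_subspace V2"
    unfolding w_def by (rule wandering_proj_mem[OF V2])
  then obtain u where u: "u \<in> wandering_subspace V2" "V1 w = V2 u"
    using assms by blast
  have "norm u = norm w"
    by (metis u(2) is_isometry_norm V1 V2)
  have "cinner w w = cinner (V1 w) x"
    by (metis w w_def cinner_wandering_proj_right cinner_cadjoint_right[OF V1])
  also have "\<dots> = cinner u (wandering_proj V2 (cadjoint V2 x))"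
    by (simp add: u cinner_wandering_proj_right cinner_cadjoint_right[OF V2])
  finally have "(norm w)\<^sup>2 \<le> (norm (wandering_proj V2 (cadjoint V2 x)))\<^sup>2"
    \<comment> \<open>Since \<open>|u| = |w|\<close>, the bound reads
      \<open>2 |w|^2 \<le> |w|^2 + |P V2* x|^2\<close>, which does the work of
      Cauchy-Schwarz.\<close>
    using two_Re_cinner_le[of u "wandering_proj V2 (cadjoint V2 x)"] \<open>norm u = norm w\<close>
    by (simp add: power2_norm_eq_Re_cinner)
  then show ?thesis
    by (simp add: w_def)
qed

text \<open>
  Tested on \<open>V\<^sub>1w\<close>, the inequality says that the projection of \<open>V\<^sub>1w\<close> onto \<open>V\<^sub>2\<W>(V\<^sub>2)\<close> does not
  decrease its norm, so \<open>V\<^sub>1w\<close> is its own projection.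
\<close>

lemma norm_le_imp_wandering_image_subset:
  assumes "\<And>x. norm (wandering_proj V2 (cadjoint V1 x)) \<le> norm (wandering_proj V2 (cadjoint V2 x))"
  shows "V1 ` wandering_subspace V2 \<subseteq> V2 ` wandering_subspace V2"
proof
  fix x
  assume "x \<in> V1 ` wandering_subspace V2"
  then obtain w where w: "w \<in> wandering_subspace V2" "x = V1 w"
    by blast
  define u where "u = wandering_proj V2 (cadjoint V2 x)"
  have u: "u \<in> wandering_subspace V2"
    unfolding u_def by (rule wandering_proj_mem[OF V2])
  have "norm x \<le> norm u"
    using assms[of x] unfolding u_def[symmetric]
    by (simp add: w cadjoint_apply[OF V1] wandering_proj_ident[OF V2] is_isometry_norm[OF V1])
  \<comment> \<open>Hence \<open>|x - V2 u|^2 = |x|^2 - |u|^2\<close>, which the preceding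
    inequality makes nonpositive.\<close>
  moreover have "cinner x (V2 u) = cinner u u"
    unfolding cinner_cadjoint_left[OF V2]
    by (metis u u_def cinner_wandering_proj_right cinner_commute)
  ultimately have "(norm (x - V2 u))\<^sup>2 \<le> 0"
    by (simp add: power2_norm_diff is_isometry_norm[OF V2] cinner_self)
  then have "x = V2 u"
    by simp
  with u show "x \<in> V2 ` wandering_subspace V2"
    by blast
qed

lemma hartogs_positive_iff_wandering:
  "positive_op (hartogs_core V1 V2) \<longleftrightarrow>
   V1 ` wandering_subspace V2 \<subseteq> V2 ` wandering_subspace V2"
  using positive_hartogs_core_iff wandering_image_subset_imp_norm_le
    norm_le_imp_wandering_image_subset by blast

section \<open>Factoring \<open>V1\<close> through \<open>V2\<close> and comparing the core
  operators\<close>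

lemma commuting_factor_exists:
  assumes "V1 ` wandering_subspace V2 \<subseteq> V2 ` wandering_subspace V2"
  obtains V3 where "is_isometry V3" and "V3 \<circ> V2 = V2 \<circ> V3" and "V1 = V2 \<circ> V3"
proof -
  have "V1 h \<in> range V2" for h
  proof -
    obtain u where u: "V1 (wandering_proj V2 h) = V2 u"
      using assms wandering_proj_mem[OF V2] by blast
    have "V1 h = V1 (wandering_proj V2 h) + V1 (V2 (cadjoint V2 h))"
      by (simp add: wandering_proj_def is_isometry_add[OF V1, symmetric])
    also have "V1 (V2 (cadjoint V2 h)) = V2 (V1 (cadjoint V2 h))"
      using comm by (metis comp_apply)
    finally have "V1 h = V2 (u + V1 (cadjoint V2 h))"
      by (simp add: u is_isometry_add[OF V2])
    then show ?thesis
      by blast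
  qed
  then have "\<forall>h. \<exists>k. V1 h = V2 k"
    by blast
  then obtain V3 where V3: "\<And>h. V1 h = V2 (V3 h)"
    using choice[of "\<lambda>h k. V1 h = V2 k"] by blast
  \<comment> \<open>\<open>V2\<close> is an injective isometry, so the properties of
    \<open>V3\<close> can be checked after applying \<open>V2\<close>, where
    \<open>V2 (V3 h)\<close> is \<open>V1 h\<close>.\<close>
  have "V3 (x + y) = V3 x + V3 y" for x y
    by (rule is_isometry_cancel[OF V2, THEN iffD1])
      (simp add: V3[symmetric] is_isometry_add V1 V2)
  moreover have "V3 (a *\<^sub>C x) = a *\<^sub>C V3 x" for a x
    by (rule is_isometry_cancel[OF V2, THEN iffD1])
      (simp add: V3[symmetric] is_isometry_scaleC V1 V2)
  moreover have "norm (V3 x) = norm x" for x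
    using is_isometry_norm[OF V1, of x] by (simp add: V3 is_isometry_norm[OF V2])
  ultimately have "is_isometry V3"
    by (simp add: is_isometry_def clinear_iff)
  \<comment> \<open>\<open>V2 V3 V2 x = V1 V2 x = V2 V1 x = V2 V2 V3 x\<close>; cancel the outer
    \<open>V2\<close>.\<close>
  moreover have "V3 (V2 x) = V2 (V3 x)" for x
    using fun_cong[OF comm, of x] by (simp add: V3 is_isometry_cancel[OF V2])
  then have "V3 \<circ> V2 = V2 \<circ> V3"
    by auto
  moreover have "V1 = V2 \<circ> V3"
    using V3 by auto
  ultimately show ?thesis
    by (rule that)
qed

end

lemma positive_hartogs_core_comp_iff:
  fixes V2 V3 :: "'a::chilbert_space \<Rightarrow> 'a"
  assumes V2: "is_isometry V2" and V3: "is_isometry V3" and comm: "V3 \<circ> V2 = V2 \<circ> V3"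
    and V1: "is_isometry (V2 \<circ> V3)"
  shows "positive_op (hartogs_core (V2 \<circ> V3) V2) \<longleftrightarrow> positive_op (bidisc_core V3 V2)"
proof -
  have "(V2 \<circ> V3) \<circ> V2 = V2 \<circ> (V2 \<circ> V3)"
    using comm by (simp add: comp_assoc)
  then have "positive_op (hartogs_core (V2 \<circ> V3) V2) \<longleftrightarrow>
    (\<forall>x. norm (wandering_proj V2 (cadjoint V3 (cadjoint V2 x))) \<le>
      norm (wandering_proj V2 (cadjoint V2 x)))"
    by (simp add: positive_hartogs_core_iff[OF V1 V2] cadjoint_comp[OF V2 V3])
  also have "\<dots> \<longleftrightarrow> (\<forall>x. norm (wandering_proj V2 (cadjoint V3 x)) \<le> norm (wandering_proj V2 x))"
    \<comment> \<open>\<open>cadjoint V2\<close> is onto, since it is a left inverse of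
      \<open>V2\<close>; so \<open>cadjoint V2 x\<close> ranges over the whole space.\<close>
    by (metis cadjoint_apply[OF V2])
  also have "\<dots> \<longleftrightarrow> positive_op (bidisc_core V3 V2)"
    by (simp add: positive_bidisc_core_iff[OF V3 V2 comm])
  finally show ?thesis .
qed

theorem theorem1p3:
  fixes V1 V2 :: "'a::chilbert_space \<Rightarrow> 'a"
  assumes "is_isometry V1" and "is_isometry V2"
    and "V1 \<circ> V2 = V2 \<circ> V1"
  shows "(positive_op (hartogs_core V1 V2) \<longleftrightarrow>
          (\<exists>V3. is_isometry V3 \<and> V3 \<circ> V2 = V2 \<circ> V3 \<and> V1 = V2 \<circ> V3 \<and>
                positive_op (bidisc_core V3 V2)))
       \<and> (positive_op (hartogs_core V1 V2) \<longleftrightarrow>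
          V1 ` wandering_subspace V2 \<subseteq> V2 ` wandering_subspace V2)"
  \<comment> \<open>Positivity of the Hartogs core produces the factor \<open>V3\<close> by way of
    the inclusion of wandering images. Positivity then transfers in both directions along any such
    factorization.\<close>
  using hartogs_positive_iff_wandering[OF assms] commuting_factor_exists[OF assms]
    positive_hartogs_core_comp_iff assms(1,2)
  by metis

end
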